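(* Assume that $(\mathbb{K}_h,\rho_h)$ is a complete metric space and that there is a function $R\mapsto C_R$ as in the context such that $\rho_h(x^*,(x+th)^* )\le C_R^2\,t$ for all $t>0$, all $R\in[1,\infty]$ and all $x\in\mathbb{K}$ with $h\le x\le Rh$. Let $\{x_n\}_{n\ge1}$ be a sequence of elements of $\mathbb{K}$ such that $r_nh\le x_n\le R_nh$ for all $n\ge1$, where $r_n\in(0,\infty)$ and $R_n\in[r_n,\infty]$. If $$\liminf_{n\to\infty}\ n\log\Big(r_n\,r_{n+1}\,C^{-2}_{(R_n+r_{n+1}^{-1})/r_n}\Big)>1,$$ then the continued fraction $z_n=[x_1,\dots,x_n]$ converges in $\rho_h$ to an element of $\mathbb{K}$.
   Context: $\mathbb{K}$ is a partially ordered abelian semigroup with neutral element $\mathbf{e}$ such that $\mathbf{e}\le x$ for all $x\in\mathbb{K}$ and $x\le y$ implies $x+z\le y+z$ (in particular $y=x+z$ implies $x\le y$). It is equipped with an order reversing involution $x\mapsto x^*$: $x^{**}=x$, and $x\le y$ implies $y^*\le x^*$ (the involution need not commute with addition). Approximants are defined by $[x_1]=x_1^*$ and $[x_1,\dots,x_{n+1}]=(x_1+[x_2,\dots,x_{n+1}])^*$, $n\ge1$. $\mathbb{K}$ has a scaling $x\mapsto ax$ by reals $a>0$ with $1x=x$, $a(bx)=(ab)x$, $a(x+y)=ax+ay$, $(a+b)x=ax+bx$, $x\le y\Rightarrow ax\le ay$, and $(ax)^*=a^{-1}x^*$. A self-polar element $h\in\mathbb{K}$ ($h^*=h$) is fixed;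 conventions: $0h=\mathbf{e}$, $\infty h=\mathbf{e}^*$. Define $\rho_h(x,y)=\inf\{t\ge0:\ x\le y+th,\ y\le x+th\}$ (with $\inf\emptyset=\infty$) and $\mathbb{K}_h=\{x\in\mathbb{K}: x\le ah\text{ for some }a>0\}$. It is assumed that $\bigcap_{t>0}\{x\in\mathbb{K}: x\le y+th\}=\{x\in\mathbb{K}:x\le y\}$ for all $y\in\mathbb{K}$; then $\rho_h$ is a metric on $\mathbb{K}_h$. $C_R$, $R\in[1,\infty]$, denotes a positive finite function, chosen non-decreasing and right-continuous in $R$; if $R_n=\infty$, the index $(R_n+r_{n+1}^{-1})/r_n$ is $\infty$. *)

theory Defs
  imports "HOL-Analysis.Analysis"
begin

text \<open>
  The semigroup \<open>\<K>\<close> is the whole type \<open>'a\<close>, with \<open>0\<close> as its neutral element \<open>e\<close>.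
  The scaling is only constrained for positive factors; its values at other factors are
  arbitrary and are never used below.
\<close>

locale scaled_involutive_semigroup =
  fixes star :: "'a::ordered_comm_monoid_add \<Rightarrow> 'a"
    and scl :: "real \<Rightarrow> 'a \<Rightarrow> 'a"
    and h :: 'a
  assumes zero_least: "0 \<le> x"
    and star_star: "star (star x) = x"
    and star_antimono: "x \<le> y \<Longrightarrow> star y \<le> star x"
    and scale_one: "scl 1 x = x"
    and scale_scale: "a > 0 \<Longrightarrow> b > 0 \<Longrightarrow> scl a (scl b x) = scl (a * b) x"
    and scale_add_right: "a > 0 \<Longrightarrow> scl a (x + y) = scl a x + scl a y"
    and scale_add_left: "a > 0 \<Longrightarrow> b > 0 \<Longrightarrow> scl (a + b) x = scl a x + scl b x"
    and scale_mono: "a > 0 \<Longrightarrow> x \<le> y \<Longrightarrow> scl a x \<le> scl a y"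
    and star_scale: "a > 0 \<Longrightarrow> star (scl a x) = scl (inverse a) (star x)"
    and self_polar: "star h = h"
    and Inter_upper: "(\<Inter>t\<in>{0<..}. {x. x \<le> y + scl t h}) = {x. x \<le> y}"

fun approximant :: "('a::plus \<Rightarrow> 'a) \<Rightarrow> 'a list \<Rightarrow> 'a" where
  "approximant star [] = undefined"
| "approximant star [x] = star x"
| "approximant star (x # y # xs) = star (x + approximant star (y # xs))"

text \<open>The multiple \<open>th\<close> for \<open>t \<in> [0, \<infinity>]\<close>, with \<open>0h = e\<close> and \<open>\<infinity>h = e\<^sup>*\<close>.\<close>

definition mult_h :: "('a::zero \<Rightarrow> 'a) \<Rightarrow> (real \<Rightarrow> 'a \<Rightarrow> 'a) \<Rightarrow> 'a \<Rightarrow> ereal \<Rightarrow> 'a" where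
  "mult_h star scl h t =
     (if t = 0 then 0 else if t = \<infinity> then star 0 else scl (real_of_ereal t) h)"

text \<open>In \<^typ>\<open>ereal\<close>, the infimum of the empty set is \<open>\<infinity>\<close>.\<close>

definition rho_h ::
  "('a::ordered_comm_monoid_add \<Rightarrow> 'a) \<Rightarrow> (real \<Rightarrow> 'a \<Rightarrow> 'a) \<Rightarrow> 'a \<Rightarrow> 'a \<Rightarrow> 'a \<Rightarrow> ereal" where
  "rho_h star scl h x y =
     Inf {ereal t |t. 0 \<le> t \<and> x \<le> y + mult_h star scl h (ereal t)
                            \<and> y \<le> x + mult_h star scl h (ereal t)}"

definition K_h :: "(real \<Rightarrow> 'a::ord \<Rightarrow> 'a) \<Rightarrow> 'a \<Rightarrow> 'a set" where
  "K_h scl h = {x. \<exists>a>0. x \<le> scl a h}"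

text \<open>
  The library's metric spaces have real-valued distances. On \<open>K_h\<close> the distance \<open>rho_h\<close> is finite
  (lemma \<open>rho_h_finite\<close>), so its real part loses nothing there.
\<close>

definition dist_h ::
  "('a::ordered_comm_monoid_add \<Rightarrow> 'a) \<Rightarrow> (real \<Rightarrow> 'a \<Rightarrow> 'a) \<Rightarrow> 'a \<Rightarrow> 'a \<Rightarrow> 'a \<Rightarrow> real" where
  "dist_h star scl h x y = real_of_ereal (rho_h star scl h x y)"

context scaled_involutive_semigroup
begin

abbreviation "mh \<equiv> mult_h star scl h"

lemma mult_h_add: "0 \<le> s \<Longrightarrow> 0 \<le> t \<Longrightarrow> mh (ereal (s + t)) = mh (ereal s) + mh (ereal t)"
  using scale_add_left[of s t h] by (auto simp: mult_h_def)

lemma mult_h_mono: assumes "0 \<le> s" "s \<le> t" shows "mh (ereal s) \<le> mh (ereal t)"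
proof -
  have "mh (ereal t) = mh (ereal s) + mh (ereal (t - s))"
    using mult_h_add[of s "t - s"] assms by simp
  then show ?thesis using add_left_mono[OF zero_least, of "mh (ereal s)"] by simp
qed

lemma rho_h_nonneg: "0 \<le> rho_h star scl h x y"
  unfolding rho_h_def by (rule Inf_greatest) auto

lemma rho_h_commute: "rho_h star scl h x y = rho_h star scl h y x"
  unfolding rho_h_def by (rule arg_cong[of _ _ Inf]) auto

lemma rho_h_leI:
  "0 \<le> t \<Longrightarrow> x \<le> y + mh (ereal t) \<Longrightarrow> y \<le> x + mh (ereal t) \<Longrightarrow> rho_h star scl h x y \<le> ereal t"
  unfolding rho_h_def by (rule Inf_lower) auto

lemma rho_h_lessD:
  assumes "rho_h star scl h x y < ereal t"
  shows "0 \<le> t \<and> x \<le> y + mh (ereal t) \<and> y \<le> x + mh (ereal t)"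
proof -
  obtain s where s: "0 \<le> s" "s < t" "x \<le> y + mh (ereal s)" "y \<le> x + mh (ereal s)"
    using assms unfolding rho_h_def Inf_less_iff by auto
  have "mh (ereal s) \<le> mh (ereal t)" using s by (intro mult_h_mono) auto
  then show ?thesis using s by (meson add_left_mono order_trans less_imp_le)
qed

lemma rho_h_finite:
  assumes "x \<in> K_h scl h" "y \<in> K_h scl h"
  shows "rho_h star scl h x y < \<infinity>"
proof -
  obtain a b where a: "a > 0" "x \<le> scl a h" and b: "b > 0" "y \<le> scl b h"
    using assms unfolding K_h_def by auto
  have m: "scl c h \<le> mh (ereal (a + b))" if "c = a \<or> c = b" for c
    using mult_h_mono[of c "a + b"] that a b by (auto simp: mult_h_def)
  have "z \<le> w + mh (ereal (a + b))" if "z \<le> mh (ereal (a + b))" for z w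
    using add_mono[OF zero_least that, of w] by simp
  then have "rho_h star scl h x y \<le> ereal (a + b)"
    using a b m by (intro rho_h_leI) (auto intro: order_trans)
  then show ?thesis by (cases "rho_h star scl h x y") auto
qed

lemma ereal_dist_h:
  "x \<in> K_h scl h \<Longrightarrow> y \<in> K_h scl h \<Longrightarrow> ereal (dist_h star scl h x y) = rho_h star scl h x y"
  using rho_h_finite[of x y] rho_h_nonneg[of x y]
  unfolding dist_h_def by (cases "rho_h star scl h x y") auto

lemma Metric_space_K_h: "Metric_space (K_h scl h) (dist_h star scl h)"
proof
  show "0 \<le> dist_h star scl h x y" for x y
    unfolding dist_h_def by (simp add: real_of_ereal_pos rho_h_nonneg)
  show "dist_h star scl h x y = dist_h star scl h y x" for x y
    unfolding dist_h_def by (simp add: rho_h_commute)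
  show "dist_h star scl h x y = 0 \<longleftrightarrow> x = y"
    if K: "x \<in> K_h scl h" "y \<in> K_h scl h" for x y
  proof
    assume "x = y"
    have "rho_h star scl h x x \<le> ereal 0" by (rule rho_h_leI) (auto simp: mult_h_def)
    then show "dist_h star scl h x y = 0"
      using rho_h_nonneg[of x x] \<open>x = y\<close> by (simp add: dist_h_def zero_ereal_def[symmetric])
  next
    assume "dist_h star scl h x y = 0"
    then have "rho_h star scl h x y = 0" using ereal_dist_h[OF K] by (simp add: zero_ereal_def)
    then have "x \<le> y + scl t h \<and> y \<le> x + scl t h" if "t > 0" for t
      using rho_h_lessD[of x y t] that by (auto simp: mult_h_def)
    then have "x \<in> (\<Inter>t\<in>{0<..}. {x. x \<le> y + scl t h})"
      "y \<in> (\<Inter>t\<in>{0<..}. {y. y \<le> x + scl t h})" by auto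
    then show "x = y" unfolding Inter_upper by simp
  qed
  show "dist_h star scl h x z \<le> dist_h star scl h x y + dist_h star scl h y z"
    if K: "x \<in> K_h scl h" "y \<in> K_h scl h" "z \<in> K_h scl h" for x y z
  proof (rule field_le_epsilon)
    fix e :: real assume e: "e > 0"
    define s where "s = dist_h star scl h x y + e / 2"
    define t where "t = dist_h star scl h y z + e / 2"
    have "rho_h star scl h x y < ereal s" "rho_h star scl h y z < ereal t"
      using e K by (auto simp: s_def t_def simp flip: ereal_dist_h)
    note s = rho_h_lessD[OF this(1)] and t = rho_h_lessD[OF this(2)]
    have le: "u \<le> w + mh (ereal (s + t))"
      if "u \<le> v + mh (ereal p)" "v \<le> w + mh (ereal q)" "p + q = s + t" "0 \<le> p" "0 \<le> q"
      for u v w p q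
    proof -
      have "u \<le> (w + mh (ereal q)) + mh (ereal p)"
        using that(1) add_right_mono[OF that(2)] by (rule order_trans)
      also have "\<dots> = w + mh (ereal (p + q))"
        using mult_h_add[OF that(4,5)] by (simp only: ac_simps)
      finally show ?thesis using that(3) by simp
    qed
    have "x \<le> z + mh (ereal (s + t))" using le[of x y s z t] s t by simp
    moreover have "z \<le> x + mh (ereal (s + t))" using le[of z y t x s] s t by simp
    ultimately have "rho_h star scl h x z \<le> ereal (s + t)"
      using s t by (intro rho_h_leI) auto
    then show "dist_h star scl h x z \<le> dist_h star scl h x y + dist_h star scl h y z + e"
      using K by (simp add: s_def t_def flip: ereal_dist_h)
  qed
qed

end

end

theory Submission imports Defs begin

text \<open>
  With \<open>f\<^sub>m u = (x\<^sub>m + u)\<^sup>*\<close> the approximant \<open>[x\<^sub>1, \<dots>, x\<^sub>n]\<close> is \<open>f\<^sub>1 (\<dots> (f\<^sub>n \<^bold>e))\<close>,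
  and a longer approximant \<open>[x\<^sub>1, \<dots>, x\<^sub>N]\<close> is \<open>f\<^sub>1 (\<dots> (f\<^sub>n v))\<close> with \<open>v = [x\<^sub>n\<^sub>+\<^sub>1, \<dots>, x\<^sub>N]\<close>.
  Since \<open>x\<^sub>n\<^sub>+\<^sub>1\<close> dominates \<open>r\<^sub>n\<^sub>+\<^sub>1 h\<close> and \<open>h\<close> is self-polar, \<open>v \<le> r\<^sub>n\<^sub>+\<^sub>1\<^sup>-\<^sup>1 h\<close>; so the innermost
  arguments \<open>\<^bold>e\<close> and \<open>v\<close> are at distance at most \<open>1 / r\<^sub>n\<^sub>+\<^sub>1\<close>.

  The assumption on \<open>C\<close> concerns elements above \<open>h\<close>. Rescaling by \<open>1 / r\<^sub>m\<close> (lemma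
  \<open>star_quasi_lipschitz\<close>) turns it into a statement about elements above \<open>r\<^sub>m h\<close>. As the scaling
  enters once before the involution and, inverted, once after it, \<open>f\<^sub>m\<close> changes distances by a
  factor of at most \<open>C\<^sub>m\<^sup>2 / r\<^sub>m\<^sup>2\<close>, with \<open>C\<^sub>m\<close> the value of \<open>C\<close> at the index
  \<open>(R\<^sub>m + r\<^sub>m\<^sub>+\<^sub>1\<^sup>-\<^sup>1) / r\<^sub>m\<close>. Multiplying the factors (lemma \<open>foldr_lipschitz\<close>) and regrouping
  the \<open>r\<^sub>m\<close> in consecutive pairs bounds the distance between the two approximants by
  \<open>(1 / r\<^sub>1) \<Prod>\<^sub>m\<^sub>\<le>\<^sub>n 1 / q\<^sub>m\<close>, where \<open>q\<^sub>m = r\<^sub>m r\<^sub>m\<^sub>+\<^sub>1 / C\<^sub>m\<^sup>2\<close>, uniformly in \<open>N\<close>.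

  The condition on the lower limit says that eventually \<open>q\<^sub>m > exp (1 / m) \<ge> (m + 1) / m\<close>, so
  the product is eventually dominated by a telescoping one and at most of order \<open>1 / n\<close> (lemma
  \<open>prod_inverse_tendsto_0\<close>). Hence the approximants form a Cauchy sequence, and completeness
  gives the limit.
\<close>

lemma approximant_eq_foldr:
  fixes star :: "'a::monoid_add \<Rightarrow> 'a"
  assumes "xs \<noteq> []"
  shows "approximant star xs = foldr (\<lambda>x u. star (x + u)) xs 0"
  using assms by (induction star xs rule: approximant.induct) auto

text \<open>The bound \<open>1 + t \<le> exp t\<close> at \<open>t = 1 / n\<close> makes \<open>n \<Prod>\<^sub>i\<^sub><\<^sub>n 1 / q\<^sub>i\<close> eventually non-increasing.\<close>

lemma prod_inverse_tendsto_0: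
  fixes q :: "nat \<Rightarrow> real"
  assumes pos: "\<And>n. 1 \<le> n \<Longrightarrow> 0 < q n"
    and ev: "\<forall>\<^sub>F n in sequentially. 1 < real n * ln (q n)"
  shows "(\<lambda>n. \<Prod>i=1..<n. inverse (q i)) \<longlonglongrightarrow> 0"
proof -
  define P where "P n = (\<Prod>i=1..<n. inverse (q i))" for n
  have P_pos: "0 < P n" for n
    unfolding P_def by (rule prod_pos) (use pos in auto)
  obtain N where N: "\<And>n. n \<ge> N \<Longrightarrow> 1 < real n * ln (q n)"
    using ev unfolding eventually_sequentially by blast
  define M where "M = max N 1"
  have bound: "real n * P n \<le> real M * P M" if "M \<le> n" for n
    using that
  proof (induction rule: dec_induct)
    case base
    show ?case by simp
  next
    case (step n)
    have n: "n \<ge> 1" "n \<ge> N" using step by (auto simp: M_def)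
    have "1 / real n < ln (q n)" using N[OF n(2)] n by (simp add: field_simps)
    then have "exp (1 / real n) < q n" using pos[OF n(1)] by (metis exp_less_mono exp_ln)
    moreover have "1 + 1 / real n \<le> exp (1 / real n)" by (rule exp_ge_add_one_self)
    ultimately have "1 + 1 / real n < q n" by (rule le_less_trans[rotated])
    then have "real (Suc n) \<le> real n * q n" using n by (simp add: field_simps)
    then have "real (Suc n) * inverse (q n) \<le> real n"
      using pos[OF n(1)] by (simp add: field_simps)
    moreover have "P (Suc n) = P n * inverse (q n)"
      unfolding P_def using n by simp
    ultimately have "real (Suc n) * P (Suc n) \<le> real n * P n"
      using mult_right_mono[of "real (Suc n) * inverse (q n)" "real n" "P n"] P_pos[of n]
      by (simp add: mult_ac)
    then show ?case using step.IH by simp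
  qed
  have le: "P n \<le> real M * P M / real n" if "M \<le> n" for n
    using bound[OF that] that by (simp add: M_def field_simps)
  have "(\<lambda>n. real M * P M / real n) \<longlonglongrightarrow> 0" by (rule lim_const_over_n)
  then have "P \<longlonglongrightarrow> 0"
    by (rule tendsto_sandwich[rotated 3, where f = "\<lambda>_. 0"])
      (auto simp: P_pos less_imp_le eventually_sequentially intro!: exI[of _ M] le)
  then show ?thesis unfolding P_def .
qed

lemma contraction_index_ge_1:
  fixes R :: ereal
  assumes "0 < a" "0 < b" "ereal a \<le> R"
  shows "1 \<le> (R + ereal (1 / b)) / ereal a"
proof (cases R)
  case (real s)
  then have "a \<le> s + 1 / b" using assms by (simp add: add_increasing2)
  then show ?thesis using assms real by (simp add: one_ereal_def)
qed (use assms in auto)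

context scaled_involutive_semigroup
begin

lemma mh_pos: "0 < t \<Longrightarrow> mh (ereal t) = scl t h"
  by (auto simp: mult_h_def)

lemma le_star_zero: "x \<le> star 0"
  using star_antimono[OF zero_least, of "star x"] by (simp add: star_star)

lemma scale_zero:
  assumes "0 < a"
  shows "scl a 0 = 0"
proof -
  have "scl a 0 \<le> scl a (scl (inverse a) 0)"
    by (rule scale_mono[OF assms zero_least])
  also have "\<dots> = 0"
    using assms by (simp add: scale_scale scale_one)
  finally show ?thesis using zero_least by (rule antisym)
qed

text \<open>For \<open>S = \<infinity>\<close> this rests on \<open>\<^bold>e\<^sup>*\<close> being fixed by the scaling.\<close>

lemma scale_mult_h:
  assumes "0 < a" "0 < S"
  shows "scl a (mh S) = mh (S * ereal a)"
proof (cases S)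
  case (real s)
  then show ?thesis using assms by (simp add: mh_pos scale_scale mult.commute)
next
  case PInf
  have "scl a (star 0) = star (scl (inverse a) 0)"
    using assms by (simp add: star_scale)
  then show ?thesis using PInf assms by (simp add: mult_h_def scale_zero)
qed (use assms in auto)

lemma add_le_mult_h:
  assumes "x \<le> mh S" "0 < S" "u \<le> scl t h" "0 < t"
  shows "x + u \<le> mh (S + ereal t)"
proof (cases S)
  case (real s)
  have "x + u \<le> mh S + mh (ereal t)"
    using assms by (intro add_mono) (simp_all add: mh_pos)
  then show ?thesis using mult_h_add[of s t] assms real by simp
next
  case PInf
  then show ?thesis by (simp add: mult_h_def le_star_zero)
qed (use assms in auto)

text \<open>
  The infimum defining \<open>\<rho>\<^sub>h\<close> is attained, because the sets \<open>{x. x \<le> y + s h}\<close>, \<open>s > t\<close>,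
  intersect in \<open>{x. x \<le> y + t h}\<close>.
\<close>

lemma rho_h_leD:
  assumes "rho_h star scl h x y \<le> ereal t" "0 \<le> t"
  shows "x \<le> y + mh (ereal t)"
proof -
  have "x \<le> (y + mh (ereal t)) + scl s h" if "0 < s" for s
  proof -
    have "rho_h star scl h x y < ereal (t + s)"
      using assms(1) that by (auto intro: le_less_trans)
    from rho_h_lessD[OF this] show ?thesis
      using mult_h_add[of t s] assms that by (simp add: mh_pos add.assoc)
  qed
  then have "x \<in> (\<Inter>s\<in>{0<..}. {x. x \<le> (y + mh (ereal t)) + scl s h})" by auto
  then show ?thesis unfolding Inter_upper by simp
qed

text \<open>
  The scaling by \<open>1 / a\<close> that brings \<open>w\<close> above \<open>h\<close> divides \<open>t\<close> by \<open>a\<close>, and undoing it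
  behind the involution divides by \<open>a\<close> once more; hence \<open>a\<^sup>2\<close>. The estimate is one-sided:
  used with the roles of \<open>w\<close> and \<open>w'\<close> exchanged it bounds \<open>\<rho>\<^sub>h\<close>.
\<close>

lemma star_quasi_lipschitz:
  assumes lip: "\<And>t y. 0 < t \<Longrightarrow> h \<le> y \<Longrightarrow> y \<le> mh S \<Longrightarrow>
        rho_h star scl h (star y) (star (y + scl t h)) \<le> ereal (L * t)"
    and "0 < L" "0 < a" "0 < t"
    and lower: "scl a h \<le> w" and upper: "scl (inverse a) w \<le> mh S"
    and w': "w' \<le> w + scl t h"
  shows "star w \<le> star w' + scl (L / a\<^sup>2 * t) h"
proof -
  define y where "y = scl (inverse a) w"
  have w: "w = scl a y" using \<open>0 < a\<close> by (simp add: y_def scale_scale scale_one)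
  have "scl (inverse a) (scl a h) \<le> y"
    unfolding y_def using \<open>0 < a\<close> by (intro scale_mono lower) simp
  then have hy: "h \<le> y" using \<open>0 < a\<close> by (simp add: scale_scale scale_one)
  have "star y \<le> star (y + scl (t / a) h) + mh (ereal (L * (t / a)))"
    using assms hy upper by (intro rho_h_leD lip) (auto simp: y_def)
  then have "star y \<le> star (y + scl (t / a) h) + scl (L * (t / a)) h"
    using assms by (simp add: mh_pos)
  then have "scl (inverse a) (star y)
      \<le> scl (inverse a) (star (y + scl (t / a) h) + scl (L * (t / a)) h)"
    using \<open>0 < a\<close> by (intro scale_mono) auto
  also have "\<dots> = star (scl a (y + scl (t / a) h)) + scl (L / a\<^sup>2 * t) h"
    using assms
    by (simp add: scale_add_right scale_scale power2_eq_square divide_inverse mult_ac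
        star_scale[symmetric])
  also have "scl a (y + scl (t / a) h) = w + scl t h"
    using assms w by (simp add: scale_add_right scale_scale)
  also have "star (w + scl t h) \<le> star w'"
    using w' by (rule star_antimono)
  finally show ?thesis
    using \<open>0 < a\<close> by (simp add: w star_scale add_right_mono)
qed

lemma star_add_le:
  assumes "0 < a" "scl a h \<le> x"
  shows "star (x + u) \<le> scl (inverse a) h"
proof -
  have "x \<le> x + u" using add_left_mono[OF zero_least] by fastforce
  then have "star (x + u) \<le> star (scl a h)"
    by (intro star_antimono) (rule order_trans[OF assms(2)])
  then show ?thesis using assms(1) by (simp add: star_scale self_polar)
qed

text \<open>
  The bound on the result is carried along in the induction: it places the argument of the
  next outer map in the range where its Lipschitz constant is controlled.
\<close>

lemma foldr_lipschitz:
  fixes C :: "ereal \<Rightarrow> real" and x :: "nat \<Rightarrow> 'a" and r :: "nat \<Rightarrow> real" and R :: "nat \<Rightarrow> ereal"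
  defines "F \<equiv> foldr (\<lambda>x u. star (x + u))"
    and "S \<equiv> \<lambda>n. (R n + ereal (1 / r (n + 1))) / ereal (r n)"
  assumes C_pos: "\<And>s. 1 \<le> s \<Longrightarrow> 0 < C s"
    and C_bound: "\<And>t s y. 0 < t \<Longrightarrow> 1 \<le> s \<Longrightarrow> h \<le> y \<Longrightarrow> y \<le> mh s \<Longrightarrow>
        rho_h star scl h (star y) (star (y + scl t h)) \<le> ereal ((C s)\<^sup>2 * t)"
    and r_pos: "\<And>n. 1 \<le> n \<Longrightarrow> 0 < r n"
    and r_le_R: "\<And>n. 1 \<le> n \<Longrightarrow> ereal (r n) \<le> R n"
    and x_lower: "\<And>n. 1 \<le> n \<Longrightarrow> scl (r n) h \<le> x n"
    and x_upper: "\<And>n. 1 \<le> n \<Longrightarrow> x n \<le> mh (R n)"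
    and "1 \<le> m" "m \<le> n" "0 < t"
    and u: "u \<le> scl (inverse (r n)) h" and v: "v \<le> scl (inverse (r n)) h"
    and uv: "u \<le> v + scl t h" and vu: "v \<le> u + scl t h"
  shows "F (map x [m..<n]) u \<le> scl (inverse (r m)) h \<and>
    F (map x [m..<n]) v \<le> scl (inverse (r m)) h \<and>
    F (map x [m..<n]) u \<le> F (map x [m..<n]) v + scl ((\<Prod>i=m..<n. (C (S i))\<^sup>2 / (r i)\<^sup>2) * t) h \<and>
    F (map x [m..<n]) v \<le> F (map x [m..<n]) u + scl ((\<Prod>i=m..<n. (C (S i))\<^sup>2 / (r i)\<^sup>2) * t) h"
  using \<open>m \<le> n\<close> \<open>1 \<le> m\<close>
proof (induction rule: inc_induct)
  case base
  then show ?case using u v uv vu by (simp add: F_def)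
next
  case (step m)
  have S_ge_1: "1 \<le> S n" if "1 \<le> n" for n
    unfolding S_def using r_pos[OF that] r_pos[of "n + 1"] r_le_R[OF that]
    by (intro contraction_index_ge_1) auto
  define U where "U = F (map x [Suc m..<n]) u"
  define V where "V = F (map x [Suc m..<n]) v"
  define T where "T = (\<Prod>i=Suc m..<n. (C (S i))\<^sup>2 / (r i)\<^sup>2) * t"
  note rp = r_pos[OF \<open>1 \<le> m\<close>] r_pos[of "Suc m"]
  have Cm: "0 < (C (S m))\<^sup>2" using C_pos[OF S_ge_1[OF \<open>1 \<le> m\<close>]] by simp
  have T: "0 < T"
    unfolding T_def using C_pos[OF S_ge_1] r_pos step \<open>0 < t\<close>
    by (intro mult_pos_pos prod_pos) (auto simp: less_imp_neq[symmetric])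
  have IH: "U \<le> scl (inverse (r (Suc m))) h" "V \<le> scl (inverse (r (Suc m))) h"
    "U \<le> V + scl T h" "V \<le> U + scl T h"
    using step.IH by (simp_all add: U_def V_def T_def)
  have F: "F (map x [m..<n]) w = star (x m + F (map x [Suc m..<n]) w)" for w
    using step.hyps by (simp add: F_def upt_conv_Cons)
  have prod: "(\<Prod>i=m..<n. (C (S i))\<^sup>2 / (r i)\<^sup>2) * t = (C (S m))\<^sup>2 / (r m)\<^sup>2 * T"
    using step.hyps by (simp add: T_def prod.atLeast_Suc_lessThan)
  have Rm: "0 < R m" using r_le_R[OF \<open>1 \<le> m\<close>] rp(1) by (cases "R m") auto
  have contract: "star (x m + a) \<le> star (x m + b) + scl ((C (S m))\<^sup>2 / (r m)\<^sup>2 * T) h"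
    if "a \<le> scl (inverse (r (Suc m))) h" "b \<le> a + scl T h" for a b
  proof (rule star_quasi_lipschitz[where S = "S m"])
    show "rho_h star scl h (star y) (star (y + scl t h)) \<le> ereal ((C (S m))\<^sup>2 * t)"
      if "0 < t" "h \<le> y" "y \<le> mh (S m)" for t y
      using that S_ge_1[OF \<open>1 \<le> m\<close>] by (intro C_bound)
    show "scl (r m) h \<le> x m + a"
      using add_mono[OF x_lower[OF \<open>1 \<le> m\<close>] zero_least] by simp
    have "x m + a \<le> mh (R m + ereal (inverse (r (Suc m))))"
      using that rp Rm x_upper[OF \<open>1 \<le> m\<close>] by (intro add_le_mult_h) auto
    then have "scl (inverse (r m)) (x m + a)
        \<le> scl (inverse (r m)) (mh (R m + ereal (inverse (r (Suc m)))))"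
      using rp by (intro scale_mono) auto
    also have "\<dots> = mh (S m)"
      using rp Rm by (subst scale_mult_h) (auto simp: S_def divide_ereal_def inverse_eq_divide add_pos_pos)
    finally show "scl (inverse (r m)) (x m + a) \<le> mh (S m)" .
    show "x m + b \<le> x m + a + scl T h"
      using add_left_mono[OF that(2), of "x m"] by (simp add: add.assoc)
  qed (use Cm T rp in auto)
  show ?case
    unfolding F prod using contract[OF IH(1,4)] contract[OF IH(2,3)]
      star_add_le[OF rp(1) x_lower[OF \<open>1 \<le> m\<close>]]
    by (simp add: U_def V_def)
qed

end

theorem theorem3p8:
  fixes star :: "'a::ordered_comm_monoid_add \<Rightarrow> 'a"
    and scl :: "real \<Rightarrow> 'a \<Rightarrow> 'a"
    and h :: 'a
    and C :: "ereal \<Rightarrow> real"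
    and x :: "nat \<Rightarrow> 'a"
    and r :: "nat \<Rightarrow> real"
    and R :: "nat \<Rightarrow> ereal"
  assumes semigroup: "scaled_involutive_semigroup star scl h"
    and complete: "Metric_space.mcomplete (K_h scl h) (dist_h star scl h)"
    and C_pos: "\<And>S. 1 \<le> S \<Longrightarrow> 0 < C S"
    and C_mono: "mono_on {1..} C"
    and C_right_cont: "\<And>S. 1 \<le> S \<Longrightarrow> continuous (at_right S) C"
    and C_bound: "\<And>t S y. 0 < t \<Longrightarrow> 1 \<le> S \<Longrightarrow> h \<le> y \<Longrightarrow> y \<le> mult_h star scl h S \<Longrightarrow>
        rho_h star scl h (star y) (star (y + scl t h)) \<le> ereal ((C S)\<^sup>2 * t)"
    and r_pos: "\<And>n. 1 \<le> n \<Longrightarrow> 0 < r n"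
    and r_le_R: "\<And>n. 1 \<le> n \<Longrightarrow> ereal (r n) \<le> R n"
    and x_lower: "\<And>n. 1 \<le> n \<Longrightarrow> scl (r n) h \<le> x n"
    and x_upper: "\<And>n. 1 \<le> n \<Longrightarrow> x n \<le> mult_h star scl h (R n)"
    and liminf: "1 < liminf (\<lambda>n. ereal (real n *
        ln (r n * r (n + 1) / (C ((R n + ereal (1 / r (n + 1))) / ereal (r n)))\<^sup>2)))"
  shows "\<exists>z. (\<lambda>n. rho_h star scl h (approximant star (map x [1..<n + 1])) z) \<longlonglongrightarrow> 0"
proof -
  interpret scaled_involutive_semigroup star scl h by (rule semigroup)
  interpret K: Metric_space "K_h scl h" "dist_h star scl h" by (rule Metric_space_K_h)
  define S where "S n = (R n + ereal (1 / r (n + 1))) / ereal (r n)" for n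
  define F where "F = foldr (\<lambda>x u. star (x + u))"
  define z where "z n = F (map x [1..<n]) 0" for n
  define q where "q n = r n * r (n + 1) / (C (S n))\<^sup>2" for n
  define P where "P n = (\<Prod>i=1..<n. inverse (q i))" for n
  have S_ge_1: "1 \<le> S n" if "1 \<le> n" for n
    unfolding S_def using r_pos[OF that] r_pos[of "n + 1"] r_le_R[OF that]
    by (intro contraction_index_ge_1) auto
  have q_pos: "0 < q n" if "1 \<le> n" for n
    using r_pos[OF that] r_pos[of "n + 1"] C_pos[OF S_ge_1[OF that]] by (simp add: q_def)
  have "\<forall>\<^sub>F n in sequentially. ereal 1 < ereal (real n * ln (q n))"
    using less_LiminfD[OF liminf] by (simp only: q_def S_def one_ereal_def)
  then have "\<forall>\<^sub>F n in sequentially. 1 < real n * ln (q n)" by (simp only: less_ereal.simps)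
  then have P_lim: "P \<longlonglongrightarrow> 0"
    unfolding P_def by (rule prod_inverse_tendsto_0[rotated, OF _ q_pos])
  note lip = foldr_lipschitz[where C = C and x = x and r = r and R = R,
      OF C_pos C_bound r_pos r_le_R x_lower x_upper,
      folded S_def F_def, simplified]
  \<comment> \<open>Distributing the square \<open>(r i)\<^sup>2\<close> over two adjacent pairs leaves one factor over at either end.\<close>
  have shift: "(\<Prod>i=1..<n. (C (S i))\<^sup>2 / (r i)\<^sup>2) * inverse (r n) = P n * inverse (r 1)"
    if "1 \<le> n" for n
    using that
  proof (induction rule: dec_induct)
    case base
    show ?case by (simp add: P_def)
  next
    case (step n)
    have "(\<Prod>i=1..<Suc n. (C (S i))\<^sup>2 / (r i)\<^sup>2) * inverse (r (Suc n))
        = ((\<Prod>i=1..<n. (C (S i))\<^sup>2 / (r i)\<^sup>2) * inverse (r n)) * inverse (q n)"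
      using step r_pos[of n] r_pos[of "Suc n"]
      by (simp add: q_def power2_eq_square field_simps)
    then show ?case using step by (simp add: P_def)
  qed
  have z_le: "z n \<le> scl (inverse (r 1)) h" if "1 \<le> n" for n
    using lip[of 1 n 1 0 0] that by (simp add: z_def zero_least)
  have z_rho: "rho_h star scl h (z n) (z k) \<le> ereal (P n * inverse (r 1))" if "1 \<le> n" "n \<le> k" for n k
  proof -
    define v where "v = F (map x [n..<k]) 0"
    have v: "v \<le> scl (inverse (r n)) h"
      using lip[of n k 1 0 0] that by (simp add: v_def zero_least)
    have "[1..<k] = [1..<n] @ [n..<k]"
      using that upt_add_eq_append[of 1 n "k - n"] by simp
    then have zk: "z k = F (map x [1..<n]) v"
      by (simp add: z_def v_def F_def)
    have "0 < r n" using r_pos that by simp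
    have P: "0 < P n * inverse (r 1)"
      unfolding P_def using q_pos r_pos[of 1] by (intro mult_pos_pos prod_pos) auto
    show ?thesis
      using lip[of 1 n "inverse (r n)" 0 v] v that \<open>0 < r n\<close> shift[OF that(1)] P
      by (intro rho_h_leI) (auto simp: zk z_def[of n] mh_pos zero_least simp del: One_nat_def)
  qed
  have z_K: "z n \<in> K_h scl h" if "1 \<le> n" for n
    using z_le[OF that] r_pos[of 1] unfolding K_h_def by (auto intro!: exI[of _ "inverse (r 1)"])
  \<comment> \<open>The composition defining \<open>z n\<close> stops before \<open>x n\<close>, so \<open>z 2\<close> is the first approximant.\<close>
  have "K.MCauchy (\<lambda>n. z (n + 2))"
    unfolding K.MCauchy_def
  proof (intro conjI allI impI)
    show "range (\<lambda>n. z (n + 2)) \<subseteq> K_h scl h" using z_K by auto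
    fix e :: real assume "0 < e"
    have "(\<lambda>n. P n * inverse (r 1)) \<longlonglongrightarrow> 0" using tendsto_mult_right[OF P_lim] by simp
    from order_tendstoD(2)[OF this \<open>0 < e\<close>] obtain N
      where N: "\<And>n. N \<le> n \<Longrightarrow> P n * inverse (r 1) < e"
      unfolding eventually_sequentially by blast
    have le: "dist_h star scl h (z (n + 2)) (z (k + 2)) < e" if "N \<le> n" "n \<le> k" for n k
    proof -
      have "ereal (dist_h star scl h (z (n + 2)) (z (k + 2))) \<le> ereal (P (n + 2) * inverse (r 1))"
        using z_rho[of "n + 2" "k + 2"] that by (simp add: ereal_dist_h z_K)
      then show ?thesis using N[of "n + 2"] that by simp
    qed
    show "\<exists>N. \<forall>n k. N \<le> n \<longrightarrow> N \<le> k \<longrightarrow> dist_h star scl h (z (n + 2)) (z (k + 2)) < e"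
      using le by (metis K.commute nle_le)
  qed
  then obtain l where l: "limitin K.mtopology (\<lambda>n. z (n + 2)) l sequentially"
    using complete unfolding K.mcomplete_def by blast
  then have lK: "l \<in> K_h scl h" and "(\<lambda>n. dist_h star scl h (z (n + 2)) l) \<longlonglongrightarrow> 0"
    unfolding K.limitin_metric_dist_null by auto
  then have "(\<lambda>n. ereal (dist_h star scl h (z (n + 2)) l)) \<longlonglongrightarrow> 0"
    by (simp add: zero_ereal_def)
  then have "(\<lambda>n. rho_h star scl h (z (Suc n + 1)) l) \<longlonglongrightarrow> 0"
    by (simp add: ereal_dist_h z_K lK)
  then have "(\<lambda>n. rho_h star scl h (approximant star (map x [1..<Suc n + 1])) l) \<longlonglongrightarrow> 0"
    by (simp add: approximant_eq_foldr z_def F_def del: upt_Suc One_nat_def)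
  then show ?thesis
    by (intro exI[of _ l]) (rule LIMSEQ_imp_Suc)
qed

end
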